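(* Let $\mathcal{H}$ and $\mathcal{G}$ be real finite-dimensional Hilbert spaces, let $g:\mathcal{H}\to\overline{\mathbb{R}}$ and $h:\mathcal{G}\to\overline{\mathbb{R}}$ be proper, convex and lower semicontinuous, let $\varphi:\mathcal{H}\to\mathbb{R}$ be convex and Fréchet differentiable with $\frac1\beta$-Lipschitz continuous gradient for some $\beta>0$, and let $K:\mathcal{H}\to\mathcal{G}$ be linear with adjoint $K^*$. Define $\Phi(x,y)=g(x)+\varphi(x)+h^*(y)-\langle y,Kx\rangle$ for $(x,y)\in\mathcal{H}\times\mathcal{G}$, and consider the three problems (P) $\min\{g(x)+\varphi(x)-h(Kx) : x\in\mathcal{H}\}$, (D) $\min\{h^*(y)-(g+\varphi)^*(K^*y) : y\in\mathcal{G}\}$, (PD) $\min\{\Phi(x,y) : x\in\mathcal{H},\, y\in\mathcal{G}\}$. Then: 1. The optimal values (infima) of (P), (D) and (PD) are equal. 2. For all $x\in\mathcal{H}$ and $y\in\mathcal{G}$, $\Phi(x,y)\ge g(x)+\varphi(x)-h(Kx)$ and $\Phi(x,y)\ge h^*(y)-(g+\varphi)^*(K^*y)$. 3. If $\bar x\in\mathcal{H}$ is a solution of (P), then $\partial(h\circ K)(\bar x)\subseteq\partial g(\bar x)+\nabla\varphi(\bar x)$. 4. If $\bar y\in\mathcal{G}$ is a solution of (D), then $\partial\big((g+\varphi)^*\circ K^*\big)(\bar y)\subseteq\partial h^*(\bar y)$. 5. If $(\bar x,\bar y)\in\mathcal{H}\times\mathcal{G}$ is a solution of (PD), then $\bar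 x$ is a solution of (P), $\bar y$ is a solution of (D), and the inclusions $K^*\bar y\in\partial g(\bar x)+\nabla\varphi(\bar x)$ and $K\bar x\in\partial h^*(\bar y)$ hold.
   Context: $\overline{\mathbb{R}}=\mathbb{R}\cup\{+\infty,-\infty\}$, with the convention $+\infty-\infty=-\infty+\infty=+\infty$ (the other sums with infinite terms being the usual ones). The domain of $f$ is $\operatorname{dom} f=\{x: f(x)<+\infty\}$; $f$ is proper if it never takes the value $-\infty$ and $\operatorname{dom} f\ne\emptyset$. The conjugate of $f$ is $f^*(x^* )=\sup_x\{\langle x^*,x\rangle-f(x)\}$. The convex subdifferential $\partial f(x)$ is $\emptyset$ if $x\notin\operatorname{dom} f$, and otherwise $\partial f(x)=\{x^* : f(y)\ge f(x)+\langle x^*,y-x\rangle\ \forall y\}$. A "solution" of a minimization problem is a global minimizer of its objective function. *)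

theory Defs
  imports "HOL-Analysis.Analysis"
begin

text \<open>
  Addition and subtraction on \<^typ>\<open>ereal\<close> already follow the convention that
  infinity minus infinity, in either order, equals plus infinity.
\<close>

definition edom :: "('a \<Rightarrow> ereal) \<Rightarrow> 'a set" where
  "edom f = {x. f x < \<infinity>}"

definition proper_fun :: "('a \<Rightarrow> ereal) \<Rightarrow> bool" where
  "proper_fun f \<longleftrightarrow> (\<forall>x. f x \<noteq> -\<infinity>) \<and> edom f \<noteq> {}"

definition convex_fun :: "('a::real_vector \<Rightarrow> ereal) \<Rightarrow> bool" where
  "convex_fun f \<longleftrightarrow> (\<forall>x y. \<forall>t\<in>{0<..<1::real}.
     f ((1 - t) *\<^sub>R x + t *\<^sub>R y) \<le> ereal (1 - t) * f x + ereal t * f y)"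

definition lsc_fun :: "('a::topological_space \<Rightarrow> ereal) \<Rightarrow> bool" where
  "lsc_fun f \<longleftrightarrow> (\<forall>x. f x \<le> Liminf (at x) f)"

definition conjugate :: "('a::real_inner \<Rightarrow> ereal) \<Rightarrow> 'a \<Rightarrow> ereal" where
  "conjugate f u = (SUP x. ereal (u \<bullet> x) - f x)"

definition subdifferential :: "('a::real_inner \<Rightarrow> ereal) \<Rightarrow> 'a \<Rightarrow> 'a set" where
  "subdifferential f x =
     (if x \<in> edom f then {u. \<forall>y. f y \<ge> f x + ereal (u \<bullet> (y - x))} else {})"

definition global_minimizer :: "('a \<Rightarrow> ereal) \<Rightarrow> 'a \<Rightarrow> bool" where
  "global_minimizer f x \<longleftrightarrow> is_arg_min f (\<lambda>_. True) x"

definition primal_objective ::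
  "('a::real_inner \<Rightarrow> ereal) \<Rightarrow> ('a \<Rightarrow> real) \<Rightarrow> ('b::real_inner \<Rightarrow> ereal) \<Rightarrow> ('a \<Rightarrow> 'b)
     \<Rightarrow> 'a \<Rightarrow> ereal" where
  "primal_objective g \<phi> h K x = g x + ereal (\<phi> x) - h (K x)"

definition dual_objective ::
  "('a::real_inner \<Rightarrow> ereal) \<Rightarrow> ('a \<Rightarrow> real) \<Rightarrow> ('b::real_inner \<Rightarrow> ereal) \<Rightarrow> ('a \<Rightarrow> 'b)
     \<Rightarrow> 'b \<Rightarrow> ereal" where
  "dual_objective g \<phi> h K y =
     conjugate h y - conjugate (\<lambda>x. g x + ereal (\<phi> x)) (adjoint K y)"

definition primal_dual_objective ::
  "('a::real_inner \<Rightarrow> ereal) \<Rightarrow> ('a \<Rightarrow> real) \<Rightarrow> ('b::real_inner \<Rightarrow> ereal) \<Rightarrow> ('a \<Rightarrow> 'b)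
     \<Rightarrow> 'a \<times> 'b \<Rightarrow> ereal" where
  "primal_dual_objective g \<phi> h K =
     (\<lambda>(x, y). g x + ereal (\<phi> x) + conjugate h y - ereal (y \<bullet> K x))"

text \<open>
  The class \<^class>\<open>euclidean_space\<close> excludes the zero space, so a finite-dimensional
  Hilbert space is rendered as a complete real inner product space with a finite spanning set.
\<close>

definition finite_dim :: "'a::real_vector itself \<Rightarrow> bool" where
  "finite_dim _ \<longleftrightarrow> (\<exists>B::'a set. finite B \<and> span B = UNIV)"

text \<open>
  The library defines \<^const>\<open>adjoint\<close> by choice and characterises it on Euclidean spaces only;
  the next lemma shows that it is the adjoint on all spaces considered here.
\<close>

lemma adjoint_works_finite_dim:
  fixes K :: "'a::real_inner \<Rightarrow> 'b::real_inner"
  assumes "finite_dim TYPE('a)" and "linear K"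
  shows "K x \<bullet> y = x \<bullet> adjoint K y"
proof -
  obtain B :: "'a set" where B: "finite B" "span B = UNIV"
    using assms(1) unfolding finite_dim_def by blast
  obtain C where C: "finite C" "span C = span B" "pairwise orthogonal C"
    using basis_orthogonal[OF B(1)] by blast
  define A where "A y = (\<Sum>c\<in>C. ((K c \<bullet> y) / (c \<bullet> c)) *\<^sub>R c)" for y
  have on_C: "K c \<bullet> y = c \<bullet> A y" if c: "c \<in> C" for c y
  proof -
    have "c \<bullet> A y = (\<Sum>d\<in>C. (K d \<bullet> y) / (d \<bullet> d) * (c \<bullet> d))"
      by (simp add: A_def inner_sum_right)
    also have "\<dots> = (\<Sum>d\<in>C. if d = c then K c \<bullet> y else 0)"
    proof (rule sum.cong)
      fix d assume d: "d \<in> C"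
      show "(K d \<bullet> y) / (d \<bullet> d) * (c \<bullet> d) = (if d = c then K c \<bullet> y else 0)"
      proof (cases "d = c")
        case True
        then show ?thesis using linear_0[OF assms(2)] by (cases "c = 0") auto
      next
        case False
        then have "c \<bullet> d = 0" using C(3) c d by (auto simp: pairwise_def orthogonal_def)
        then show ?thesis using False by simp
      qed
    qed simp
    also have "\<dots> = K c \<bullet> y" using C(1) c by simp
    finally show ?thesis by simp
  qed
  have A: "K x \<bullet> y = x \<bullet> A y" for x y
  proof -
    have "x \<in> span C" using B C by simp
    then show ?thesis
      by (induction rule: span_induct_alt)
        (simp_all add: linear_0[OF assms(2)] linear_add[OF assms(2)] linear_cmul[OF assms(2)]
          inner_add_left on_C)
  qed
  have "\<forall>x y. K x \<bullet> y = x \<bullet> adjoint K y"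
    unfolding adjoint_def by (rule someI[where x = A]) (simp add: A)
  then show ?thesis by blast
qed

end

theory Submission
  imports Defs
begin

text \<open>
  Minimizing \<open>\<Phi>(x, y)\<close> over \<open>y\<close> gives \<open>g x + \<phi> x - h** (K x)\<close>, which is the primal objective by the
  Fenchel--Moreau theorem; minimizing over \<open>x\<close> gives the dual objective by the definition of the
  conjugate. So the three infima coincide, and a minimizer of \<open>\<Phi>\<close> minimizes each marginal. The
  inclusions all come from one observation: if \<open>x\<close> minimizes \<open>f - k\<close>, every affine minorant of \<open>k\<close>
  touching at \<open>x\<close> becomes, shifted by \<open>f x - k x\<close>, an affine minorant of \<open>f\<close> touching at \<open>x\<close>.
  Fenchel--Moreau itself is obtained by projecting onto the epigraph.
\<close>

section \<open>Projection onto complete convex sets and epigraphs\<close>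

text \<open>A minimizing sequence is Cauchy by the parallelogram law, because midpoints stay in the
  convex set; completeness then supplies the limit, without any compactness.\<close>

lemma closest_point_exists_complete:
  fixes S :: "'a::real_inner set"
  assumes "convex S" "complete S" "S \<noteq> {}"
  obtains p where "p \<in> S" "\<forall>x\<in>S. dist z p \<le> dist z x"
proof -
  define D where "D = (INF x\<in>S. (dist z x)\<^sup>2)"
  have D: "D \<le> (dist z x)\<^sup>2" if "x \<in> S" for x
    unfolding D_def using that by (intro cINF_lower bdd_belowI2[where m = 0]) auto
  have "\<exists>x\<in>S. (dist z x)\<^sup>2 < D + e" if "e > 0" for e
    using cInf_lessD[of "(\<lambda>x. (dist z x)\<^sup>2) ` S" "D + e"] assms(3) that
    by (auto simp: D_def)
  then have "\<forall>n. \<exists>x\<in>S. (dist z x)\<^sup>2 < D + 1 / (real n + 1)" by simp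
  then obtain X where X: "\<And>n. X n \<in> S" "\<And>n. (dist z (X n))\<^sup>2 < D + 1 / (real n + 1)"
    by metis
  have parallelogram: "(dist a b)\<^sup>2 = 2 * (dist z a)\<^sup>2 + 2 * (dist z b)\<^sup>2
      - 4 * (dist z ((1/2) *\<^sub>R a + (1/2) *\<^sub>R b))\<^sup>2" for a b
    unfolding dist_norm power2_norm_eq_inner
    by (simp add: algebra_simps inner_commute)
  have close: "(dist (X m) (X n))\<^sup>2 \<le> 2 / (real m + 1) + 2 / (real n + 1)" for m n
  proof -
    have "(1/2) *\<^sub>R X m + (1/2) *\<^sub>R X n \<in> S"
      using convexD[OF assms(1) X(1) X(1), of "1/2" "1/2"] by simp
    \<comment> \<open>The midpoint contributes at least \<open>4 * D\<close>, which cancels the two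
      copies of \<open>2 * D\<close> and leaves only the slacks of \<open>X m\<close> and
      \<open>X n\<close>.\<close>
    from D[OF this] show ?thesis
      using X(2)[of m] X(2)[of n] by (subst parallelogram) simp
  qed
  have "Cauchy X"
  proof (rule metric_CauchyI)
    fix e :: real assume "e > 0"
    then obtain N where N: "4 / e\<^sup>2 < real N"
      using reals_Archimedean2 by blast
    have "dist (X m) (X n) < e" if "N \<le> m" "N \<le> n" for m n
    proof -
      have "2 / (real m + 1) \<le> 2 / (real N + 1)" "2 / (real n + 1) \<le> 2 / (real N + 1)"
        using that by (auto intro!: divide_left_mono)
      moreover have "4 / (real N + 1) < e\<^sup>2"
        using N \<open>e > 0\<close> by (simp add: field_simps)
          (smt (verit) zero_less_power)
      ultimately have "(dist (X m) (X n))\<^sup>2 < e\<^sup>2"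
        using close[of m n] by simp
      then show ?thesis using \<open>e > 0\<close> by (simp add: power2_less_imp_less)
    qed
    then show "\<exists>M. \<forall>m\<ge>M. \<forall>n\<ge>M. dist (X m) (X n) < e" by blast
  qed
  then obtain p where p: "p \<in> S" "X \<longlonglongrightarrow> p"
    using assms(2) X(1) unfolding complete_def by blast
  have "(\<lambda>n. (dist z (X n))\<^sup>2) \<longlonglongrightarrow> (dist z p)\<^sup>2"
    by (intro tendsto_intros p)
  moreover have "(\<lambda>n. D + 1 / (real n + 1)) \<longlonglongrightarrow> D + 0"
    by (intro tendsto_intros LIMSEQ_inverse_real_of_nat[unfolded inverse_eq_divide, THEN Lim_transform_eventually])
      (auto simp: add.commute)
  ultimately have "(dist z p)\<^sup>2 \<le> D"
    using LIMSEQ_le X(2) by (smt (verit, ccfv_threshold) less_imp_le)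
  then have "dist z p \<le> dist z x" if "x \<in> S" for x
    using D[OF that] by (meson order_trans power2_le_imp_le zero_le_dist)
  with p(1) that show thesis by blast
qed

lemma convex_ereal_epigraph:
  assumes "convex_fun f"
  shows "convex {(x, r). f x \<le> ereal r}"
proof (clarsimp simp: convex_alt)
  fix x r y s and t :: real
  assume f: "f x \<le> ereal r" "f y \<le> ereal s" and t: "0 \<le> t" "t \<le> 1"
  show "f ((1 - t) *\<^sub>R x + t *\<^sub>R y) \<le> ereal ((1 - t) * r + t * s)"
  proof (cases "t = 0 \<or> t = 1")
    case False
    then have t: "t \<in> {0<..<1}" using t by auto
    then have "f ((1 - t) *\<^sub>R x + t *\<^sub>R y) \<le> ereal (1 - t) * f x + ereal t * f y"
      using assms by (simp add: convex_fun_def)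
    also have "\<dots> \<le> ereal (1 - t) * ereal r + ereal t * ereal s"
      using f t by (intro add_mono ereal_mult_left_mono) auto
    finally show ?thesis by simp
  qed (use f in auto)
qed

lemma closed_ereal_epigraph:
  fixes f :: "'a::metric_space \<Rightarrow> ereal"
  assumes "lsc_fun f"
  shows "closed {(x, r). f x \<le> ereal r}"
proof -
  have seq: "f x \<le> ereal r"
    if le: "\<And>n. f (X n) \<le> ereal (R n)" and X: "X \<longlonglongrightarrow> x" and R: "R \<longlonglongrightarrow> r" for X R x r
  proof (rule ccontr)
    assume "\<not> f x \<le> ereal r"
    then obtain q where q: "ereal r < ereal q" "ereal q < f x"
      by (meson ereal_dense2 not_le)
    from q(2) have "\<forall>\<^sub>F y in at x. ereal q < f y"
      using assms unfolding lsc_fun_def le_Liminf_iff by blast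
    \<comment> \<open>The limit in \<open>lsc_fun\<close> omits the point \<open>x\<close> itself;
      \<open>q(2)\<close> restores it, since the sequence \<open>X\<close> may hit
      \<open>x\<close>.\<close>
    with q(2) have "\<forall>\<^sub>F y in nhds x. ereal q < f y"
      by (simp add: eventually_nhds_conv_at)
    with X have "\<forall>\<^sub>F n in sequentially. ereal q < f (X n)"
      using filterlim_iff by fast
    moreover have "\<forall>\<^sub>F n in sequentially. R n < q"
      using order_tendstoD(2)[OF R] q(1) by simp
    ultimately have "\<forall>\<^sub>F n in sequentially. False"
    proof eventually_elim
      case (elim n)
      then show ?case using le[of n] by (metis ereal_less_le less_ereal.simps(1) not_less order.strict_trans)
    qed
    then show False by simp
  qed
  show ?thesis
    unfolding closed_sequential_limits
  proof (intro allI impI, elim conjE)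
    fix Z z
    assume "\<forall>n. Z n \<in> {(x, r). f x \<le> ereal r}" "Z \<longlonglongrightarrow> z"
    then show "z \<in> {(x, r). f x \<le> ereal r}"
      using seq[of "\<lambda>n. fst (Z n)" "\<lambda>n. snd (Z n)" "fst z" "snd z"]
        tendsto_fst[of Z z] tendsto_snd[of Z z]
      by (auto simp: case_prod_beta)
  qed
qed

text \<open>The inequality is the obtuse-angle property of the projection \<open>(p, s)\<close> of
  \<open>(x, r)\<close> onto the epigraph, split into its two coordinates. Testing it with the
  higher point \<open>(p, s + 1)\<close> yields \<open>r \<le> s\<close>.\<close>

lemma projection_ereal_epigraph:
  fixes f :: "'a::{real_inner, complete_space} \<Rightarrow> ereal"
  assumes "proper_fun f" "convex_fun f" "lsc_fun f"
  obtains p s where "f p \<le> ereal s" "r \<le> s"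
    "\<And>y t. f y \<le> ereal t \<Longrightarrow> (x - p) \<bullet> (y - p) \<le> (s - r) * (t - s)"
proof -
  let ?E = "{(x, r). f x \<le> ereal r}"
  obtain x0 where x0: "f x0 < \<infinity>" "f x0 \<noteq> -\<infinity>"
    using assms(1) by (auto simp: proper_fun_def edom_def)
  then obtain r0 where "f x0 = ereal r0" by (cases "f x0") auto
  then have ne: "?E \<noteq> {}" by (auto intro!: exI[of _ x0] exI[of _ r0])
  have E: "convex ?E" "closed ?E"
    using assms convex_ereal_epigraph closed_ereal_epigraph by blast+
  then obtain p s where ps: "(p, s) \<in> ?E" "\<forall>z\<in>?E. dist (x, r) (p, s) \<le> dist (x, r) z"
    using closest_point_exists_complete[OF E(1) _ ne, of "(x, r)"]
    by (metis (no_types, lifting) complete_eq_closed surj_pair)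
  have *: "(x - p) \<bullet> (y - p) \<le> (s - r) * (t - s)" if "f y \<le> ereal t" for y t
  proof -
    have "((x, r) - (p, s)) \<bullet> ((y, t) - (p, s)) \<le> 0"
      using any_closest_point_dot[OF E ps(1) _ ps(2), of "(y, t)"] that by simp
    then show ?thesis by (simp add: algebra_simps)
  qed
  have "f p \<le> ereal (s + 1)"
    using ps(1) by (auto intro: order_trans)
  from *[OF this] have "r \<le> s" by simp
  with ps(1) * that show thesis by auto
qed

section \<open>Affine minorants from separating hyperplanes\<close>

text \<open>For \<open>r < s\<close> the separating hyperplane is not vertical, so dividing by
  \<open>s - r\<close> makes it the graph of an affine function through \<open>(p, s)\<close>. At
  \<open>x\<close> its value is at least \<open>s\<close>, hence above \<open>r\<close>.\<close>

lemma affine_minorant_of_projection: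
  fixes f :: "'a::real_inner \<Rightarrow> ereal"
  assumes "\<And>y. f y \<noteq> -\<infinity>" "r < s"
    and proj: "\<And>y t. f y \<le> ereal t \<Longrightarrow> (x - p) \<bullet> (y - p) \<le> (s - r) * (t - s)"
  obtains v c where "\<And>y. ereal (v \<bullet> y - c) \<le> f y" "r < v \<bullet> x - c"
proof -
  define v where "v = (1 / (s - r)) *\<^sub>R (x - p)"
  define c where "c = v \<bullet> p - s"
  have affine: "v \<bullet> y - c = s + ((x - p) \<bullet> (y - p)) / (s - r)" for y
    by (simp add: v_def c_def inner_diff_right diff_divide_distrib)
  have "ereal (v \<bullet> y - c) \<le> f y" for y
  proof (cases "f y")
    case (real t)
    then have "(x - p) \<bullet> (y - p) \<le> (s - r) * (t - s)" by (intro proj) simp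
    then have "v \<bullet> y - c \<le> t"
      using assms(2) by (simp add: affine field_simps)
    then show ?thesis using real by simp
  qed (use assms(1) in auto)
  moreover have "0 \<le> ((x - p) \<bullet> (x - p)) / (s - r)"
    using assms(2) by simp
  then have "r < v \<bullet> x - c"
    using assms(2) unfolding affine by linarith
  ultimately show thesis using that by blast
qed

text \<open>A vertical hyperplane cannot arise at a point where \<open>f\<close> is finite. This
  yields some affine minorant, which then serves to treat the vertical case at points outside the
  domain.\<close>

lemma affine_minorant:
  fixes f :: "'a::{real_inner, complete_space} \<Rightarrow> ereal"
  assumes f: "proper_fun f" "convex_fun f" "lsc_fun f" and "ereal r < f x"
  obtains v c where "\<And>y. ereal (v \<bullet> y - c) \<le> f y" "r < v \<bullet> x - c"
proof -
  have finite: "\<And>y. f y \<noteq> -\<infinity>"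
    using f(1) by (simp add: proper_fun_def)
  have domain: "\<exists>v c. \<forall>y. ereal (v \<bullet> y - c) \<le> f y" if fx: "ereal r < f x" "f x < \<infinity>" for r x
  proof -
    obtain p s where ps: "f p \<le> ereal s" "r \<le> s"
        "\<And>y t. f y \<le> ereal t \<Longrightarrow> (x - p) \<bullet> (y - p) \<le> (s - r) * (t - s)"
      using projection_ereal_epigraph[OF f] by blast
    obtain t where t: "f x = ereal t"
      using fx(2) finite[of x] by (cases "f x") auto
    \<comment> \<open>If \<open>r = s\<close>, testing the projection inequality with the epigraph
      point \<open>(x, t)\<close> forces \<open>x = p\<close>, and then
      \<open>f x \<le> r\<close>.\<close>
    have "r \<noteq> s"
    proof
      assume "r = s"
      then have "(x - p) \<bullet> (x - p) \<le> 0" using ps(3)[of x t] t by simp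
      then have "x = p" using inner_gt_zero_iff[of "x - p"] by fastforce
      then show False using ps(1) fx(1) \<open>r = s\<close> by simp
    qed
    then have "r < s" using ps(2) by simp
    from affine_minorant_of_projection[of f, OF finite this ps(3)] show ?thesis by blast
  qed
  obtain p s where ps: "f p \<le> ereal s" "r \<le> s"
      "\<And>y t. f y \<le> ereal t \<Longrightarrow> (x - p) \<bullet> (y - p) \<le> (s - r) * (t - s)"
    using projection_ereal_epigraph[OF f] by blast
  show thesis
  proof (cases "r = s")
    case False
    then have "r < s" using ps(2) by simp
    from affine_minorant_of_projection[of f, OF finite this ps(3)] that show thesis by blast
  next
    case True
    \<comment> \<open>The separating hyperplane is vertical: adding a large multiple of it to some affine
      minorant lifts the value at \<open>x\<close> while staying below \<open>f\<close>.\<close>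
    obtain x0 where "f x0 < \<infinity>"
      using f(1) by (auto simp: proper_fun_def edom_def)
    moreover from this obtain r0 where "f x0 = ereal r0"
      using finite[of x0] by (cases "f x0") auto
    ultimately obtain v c where vc: "\<And>y. ereal (v \<bullet> y - c) \<le> f y"
      using domain[of "r0 - 1" x0] by auto
    have "x \<noteq> p" using ps(1) True assms(4) by auto
    then have pos: "(x - p) \<bullet> (x - p) > 0" by simp
    \<comment> \<open>The multiple is chosen so that the lift at \<open>x\<close> exceeds the gap
      between \<open>r\<close> and the old minorant by at least 1.\<close>
    define m where "m = (\<bar>r - (v \<bullet> x - c)\<bar> + 1) / ((x - p) \<bullet> (x - p))"
    have m: "m \<ge> 0" "m * ((x - p) \<bullet> (x - p)) = \<bar>r - (v \<bullet> x - c)\<bar> + 1"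
      using pos by (auto simp: m_def)
    have affine: "(v + m *\<^sub>R (x - p)) \<bullet> y - (c + m * ((x - p) \<bullet> p))
        = v \<bullet> y - c + m * ((x - p) \<bullet> (y - p))" for y
      by (simp add: inner_add_left inner_diff_right algebra_simps)
    show thesis
    proof (rule that)
      fix y
      show "ereal ((v + m *\<^sub>R (x - p)) \<bullet> y - (c + m * ((x - p) \<bullet> p))) \<le> f y"
      proof (cases "f y")
        case (real t)
        \<comment> \<open>With \<open>r = s\<close> the right-hand side of the projection inequality
          vanishes, so the added term is nonpositive on the domain of \<open>f\<close>.\<close>
        then have "(x - p) \<bullet> (y - p) \<le> 0"
          using ps(3)[of y t] True by simp
        then have "m * ((x - p) \<bullet> (y - p)) \<le> 0"
          using m(1) by (simp add: mult_nonneg_nonpos)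
        then have "ereal (v \<bullet> y - c + m * ((x - p) \<bullet> (y - p))) \<le> ereal (v \<bullet> y - c)" by simp
        with vc[of y] show ?thesis unfolding affine by (rule order_trans[rotated])
      qed (use finite in auto)
      show "r < (v + m *\<^sub>R (x - p)) \<bullet> x - (c + m * ((x - p) \<bullet> p))"
        unfolding affine m(2) by simp
    qed
  qed
qed

section \<open>Conjugates and biconjugation\<close>

lemma conjugate_le_of_affine_minorant:
  assumes "\<And>y. ereal (v \<bullet> y - c) \<le> f y"
  shows "conjugate f v \<le> ereal c"
  unfolding conjugate_def
proof (rule SUP_least)
  fix y
  show "ereal (v \<bullet> y) - f y \<le> ereal c"
    using assms[of y] by (cases "f y") auto
qed

lemma Fenchel_Young:
  assumes "f x \<noteq> -\<infinity>"
  shows "ereal (u \<bullet> x) - conjugate f u \<le> f x"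
proof -
  have "ereal (u \<bullet> x) - f x \<le> conjugate f u"
    unfolding conjugate_def by (rule SUP_upper) simp
  then show ?thesis
    using assms by (cases "f x"; cases "conjugate f u") auto
qed

text \<open>The slope of any affine minorant is a point where the conjugate is below infinity, and
  one finite value of \<open>f\<close> keeps the conjugate away from minus infinity.\<close>

lemma proper_conjugate:
  fixes f :: "'a::{real_inner, complete_space} \<Rightarrow> ereal"
  assumes "proper_fun f" "convex_fun f" "lsc_fun f"
  shows "proper_fun (conjugate f)"
proof -
  obtain x where x: "f x < \<infinity>" "f x \<noteq> -\<infinity>"
    using assms(1) by (auto simp: proper_fun_def edom_def)
  then obtain r where r: "f x = ereal r" by (cases "f x") auto
  have "ereal (r - 1) < f x" by (simp add: r)
  from affine_minorant[OF assms this]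
  obtain v c where "\<And>y. ereal (v \<bullet> y - c) \<le> f y" by blast
  from conjugate_le_of_affine_minorant[OF this] have "conjugate f v < \<infinity>"
    by (rule le_less_trans) simp
  moreover have "conjugate f u \<noteq> -\<infinity>" for u
    using Fenchel_Young[of f x u] x(2) x(1) by auto
  ultimately show ?thesis by (auto simp: proper_fun_def edom_def)
qed

text \<open>One inequality is the supremum of Fenchel--Young over all slopes. For the other, an
  affine minorant with slope \<open>v\<close> that exceeds \<open>r\<close> at \<open>x\<close>
  bounds \<open>conjugate f v\<close> by \<open>c\<close>, which pushes the biconjugate at
  \<open>x\<close> up to \<open>r\<close>.\<close>

lemma Fenchel_Moreau:
  fixes f :: "'a::{real_inner, complete_space} \<Rightarrow> ereal"
  assumes "proper_fun f" "convex_fun f" "lsc_fun f"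
  shows "conjugate (conjugate f) = f"
proof (rule ext, rule antisym)
  fix x
  have "f x \<noteq> -\<infinity>" using assms(1) by (simp add: proper_fun_def)
  from Fenchel_Young[of f x, OF this] show "conjugate (conjugate f) x \<le> f x"
    by (subst conjugate_def) (auto intro!: SUP_least simp: inner_commute)
  show "f x \<le> conjugate (conjugate f) x"
  proof (rule ccontr)
    assume "\<not> ?thesis"
    then obtain r where r: "conjugate (conjugate f) x < ereal r" "ereal r < f x"
      by (meson ereal_dense2 not_le)
    obtain v c where vc: "\<And>y. ereal (v \<bullet> y - c) \<le> f y" "r < v \<bullet> x - c"
      using affine_minorant[OF assms r(2)] by blast
    have "ereal r \<le> ereal (x \<bullet> v) - ereal c"
      using vc(2) by (simp add: inner_commute)
    also have "\<dots> \<le> ereal (x \<bullet> v) - conjugate f v"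
      by (intro ereal_minus_mono conjugate_le_of_affine_minorant vc order_refl)
    also have "\<dots> \<le> conjugate (conjugate f) x"
      by (subst (2) conjugate_def) (auto intro: SUP_upper)
    finally show False using r(1) by simp
  qed
qed

section \<open>Partial minimization of extended-real functions\<close>

lemma uminus_conjugate: "- conjugate f u = (INF x. f x - ereal (u \<bullet> x))"
proof -
  have "- (ereal a - z) = z - ereal a" for a z
    by (cases z) auto
  then show ?thesis
    unfolding conjugate_def by (simp flip: ereal_INF_uminus_eq)
qed

text \<open>For infinite \<open>c\<close> the convention on sums matters: both sides are plus
  infinity even when the infimum of \<open>F\<close> is minus infinity.\<close>

lemma INF_ereal_add_const:
  fixes F :: "'a \<Rightarrow> ereal"
  assumes "c \<noteq> -\<infinity>"
  shows "(INF x. c + F x) = c + (INF x. F x)"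
proof (cases c)
  case (real r)
  then show ?thesis
    using INF_ereal_minus_right[of UNIV c "\<lambda>x. - F x"]
    by (simp add: ereal_SUP_uminus_eq minus_ereal_def)
qed (use assms in auto)

lemma INF_UNIV_pair:
  fixes f :: "'a \<times> 'b \<Rightarrow> 'c::complete_lattice"
  shows "(INF p. f p) = (INF x. INF y. f (x, y))"
  by (rule antisym) (auto intro!: INF_greatest INF_lower intro: INF_lower2 simp: split_paired_all)

section \<open>First-order conditions and the sum rule\<close>

lemma subdifferential_subset_of_minimizer:
  assumes f: "proper_fun f" and k: "\<And>x. k x \<noteq> -\<infinity>"
    and min: "global_minimizer (\<lambda>x. f x - k x) x"
  shows "subdifferential k x \<subseteq> subdifferential f x"
proof
  fix u assume "u \<in> subdifferential k x"
  then have kx: "k x < \<infinity>" and u: "k x + ereal (u \<bullet> (y - x)) \<le> k y" for y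
    by (auto simp: subdifferential_def edom_def split: if_splits)
  from kx k[of x] obtain b where b: "k x = ereal b" by (cases "k x") auto
  have le: "f x - k x \<le> f y - k y" for y
    using min by (simp add: global_minimizer_def is_arg_min_linorder)
  have fin: "f y \<noteq> -\<infinity>" for y using f by (simp add: proper_fun_def)
  obtain x0 where "f x0 < \<infinity>"
    using f by (auto simp: proper_fun_def edom_def)
  \<comment> \<open>An infinite \<open>f x\<close> would make the minimal value plus infinity, since
    \<open>k x\<close> is real; yet the objective at \<open>x0\<close> is below infinity.\<close>
  with le[of x0] b fin[of x] fin[of x0] k[of x0] obtain a where a: "f x = ereal a"
    by (cases "f x"; cases "f x0"; cases "k x0") auto
  \<comment> \<open>If \<open>k y\<close> is infinite, minimality together with the finite value at
    \<open>x\<close> forces \<open>f y\<close> to be infinite too, so the bound still holds.\<close>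
  have "f x + ereal (u \<bullet> (y - x)) \<le> f y" for y
    using le[of y] u[of y] a b fin[of y] k[of y] by (cases "f y"; cases "k y") auto
  with a show "u \<in> subdifferential f x"
    by (simp add: subdifferential_def edom_def)
qed

text \<open>The case of a linear subtracted function, whose slope is a subgradient of it at every
  point.\<close>

lemma mem_subdifferential_of_minimizer:
  assumes "proper_fun f" "\<And>y. f x - ereal (u \<bullet> x) \<le> f y - ereal (u \<bullet> y)"
  shows "u \<in> subdifferential f x"
proof -
  have "u \<in> subdifferential (\<lambda>y. ereal (u \<bullet> y)) x"
    by (simp add: subdifferential_def edom_def inner_diff_right)
  also have "\<dots> \<subseteq> subdifferential f x"
    using assms by (intro subdifferential_subset_of_minimizer)
      (auto simp: global_minimizer_def is_arg_min_linorder)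
  finally show ?thesis .
qed

text \<open>Along the segment from \<open>x\<close> to \<open>y\<close>, convexity bounds the
  increment of \<open>g\<close> by \<open>t\<close> times the full increment. The subgradient
  inequality then bounds the difference quotients of \<open>\<phi>\<close> below by a constant, and
  letting \<open>t\<close> tend to 0 replaces them by the directional derivative.\<close>

lemma subdifferential_add_differentiable:
  assumes fin: "\<And>x. g x \<noteq> -\<infinity>" and "convex_fun g" and "GDERIV \<phi> x :> d"
  shows "subdifferential (\<lambda>x. g x + ereal (\<phi> x)) x \<subseteq> (\<lambda>u. u + d) ` subdifferential g x"
proof
  fix u assume u: "u \<in> subdifferential (\<lambda>x. g x + ereal (\<phi> x)) x"
  then have "g x + ereal (\<phi> x) < \<infinity>"
    and le: "g x + ereal (\<phi> x) + ereal (u \<bullet> (y - x)) \<le> g y + ereal (\<phi> y)" for y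
    by (auto simp: subdifferential_def edom_def split: if_splits)
  then obtain a where a: "g x = ereal a"
    using fin[of x] by (cases "g x") auto
  have "g x + ereal ((u - d) \<bullet> (y - x)) \<le> g y" for y
  proof (cases "g y")
    case (real b)
    have quotient: "a - b + u \<bullet> (y - x) \<le> (\<phi> (x + t *\<^sub>R (y - x)) - \<phi> x) / t"
      if t: "t \<in> {0<..<1}" for t
    proof -
      let ?z = "(1 - t) *\<^sub>R x + t *\<^sub>R y"
      have z: "?z = x + t *\<^sub>R (y - x)" by (simp add: algebra_simps)
      have "g ?z \<le> ereal (1 - t) * g x + ereal t * g y"
        using assms(2) t by (auto simp: convex_fun_def)
      then have "g ?z \<le> ereal ((1 - t) * a + t * b)" by (simp add: a real)
      \<comment> \<open>The subgradient inequality is tested at the intermediate point, where the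
        displacement is \<open>t\<close> times \<open>y - x\<close>.\<close>
      moreover have "ereal (a + \<phi> x + u \<bullet> (?z - x)) \<le> g ?z + ereal (\<phi> ?z)"
        using le[of ?z] by (simp add: a)
      ultimately have "a + \<phi> x + u \<bullet> (?z - x) \<le> (1 - t) * a + t * b + \<phi> ?z"
        using fin[of ?z] by (cases "g ?z") auto
      then have "t * (a - b + u \<bullet> (y - x)) \<le> \<phi> (x + t *\<^sub>R (y - x)) - \<phi> x"
        unfolding z by (simp add: algebra_simps)
      then show ?thesis using t by (simp add: field_simps)
    qed
    have "((\<lambda>t. \<phi> (x + t *\<^sub>R (y - x))) has_derivative (\<lambda>t. (t *\<^sub>R (y - x)) \<bullet> d)) (at 0)"
      by (rule has_derivative_compose[where g = \<phi>])
        (use assms(3) in \<open>auto simp: gderiv_def intro!: derivative_eq_intros\<close>)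
    then have "DERIV (\<lambda>t. \<phi> (x + t *\<^sub>R (y - x))) 0 :> (y - x) \<bullet> d"
      by (simp add: has_field_derivative_def mult_commute_abs)
    then have "((\<lambda>t. (\<phi> (x + t *\<^sub>R (y - x)) - \<phi> x) / t) \<longlongrightarrow> (y - x) \<bullet> d) (at_right 0)"
      by (auto simp: DERIV_def intro: tendsto_within_subset)
    moreover have "\<forall>\<^sub>F t in at_right 0. a - b + u \<bullet> (y - x)
        \<le> (\<phi> (x + t *\<^sub>R (y - x)) - \<phi> x) / t"
      using quotient by (auto simp: eventually_at_right_field intro!: exI[of _ 1])
    ultimately have "a - b + u \<bullet> (y - x) \<le> (y - x) \<bullet> d"
      by (intro tendsto_lowerbound) auto
    then show ?thesis
      by (simp add: a real inner_diff_left inner_commute)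
  qed (use fin in auto)
  then have "u - d \<in> subdifferential g x"
    using a by (simp add: subdifferential_def edom_def)
  then show "u \<in> (\<lambda>u. u + d) ` subdifferential g x"
    by (intro image_eqI[of _ _ "u - d"]) simp_all
qed

section \<open>Equal optimal values, weak duality and optimality conditions\<close>

theorem proposition1:
  fixes g :: "'a::{real_inner, complete_space} \<Rightarrow> ereal"
    and h :: "'b::{real_inner, complete_space} \<Rightarrow> ereal"
    and \<phi> :: "'a \<Rightarrow> real" and grad_\<phi> :: "'a \<Rightarrow> 'a"
    and K :: "'a \<Rightarrow> 'b" and \<beta> :: real
  assumes "finite_dim TYPE('a)" and "finite_dim TYPE('b)"
    and "proper_fun g" and "convex_fun g" and "lsc_fun g"
    and "proper_fun h" and "convex_fun h" and "lsc_fun h"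
    and "convex_on UNIV \<phi>" and "\<forall>x. GDERIV \<phi> x :> grad_\<phi> x"
    and "\<beta> > 0" and "(1 / \<beta>)-lipschitz_on UNIV grad_\<phi>"
    and "linear K"
  shows
    "((INF x. primal_objective g \<phi> h K x) = (INF y. dual_objective g \<phi> h K y)
      \<and> (INF y. dual_objective g \<phi> h K y) = (INF p. primal_dual_objective g \<phi> h K p))
    \<and> (\<forall>x y. primal_dual_objective g \<phi> h K (x, y) \<ge> primal_objective g \<phi> h K x
      \<and> primal_dual_objective g \<phi> h K (x, y) \<ge> dual_objective g \<phi> h K y)
    \<and> (\<forall>xb. global_minimizer (primal_objective g \<phi> h K) xb \<longrightarrow>
        subdifferential (h \<circ> K) xb \<subseteq> (\<lambda>u. u + grad_\<phi> xb) ` subdifferential g xb)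
    \<and> (\<forall>yb. global_minimizer (dual_objective g \<phi> h K) yb \<longrightarrow>
        subdifferential (conjugate (\<lambda>x. g x + ereal (\<phi> x)) \<circ> adjoint K) yb
          \<subseteq> subdifferential (conjugate h) yb)
    \<and> (\<forall>xb yb. global_minimizer (primal_dual_objective g \<phi> h K) (xb, yb) \<longrightarrow>
        global_minimizer (primal_objective g \<phi> h K) xb
        \<and> global_minimizer (dual_objective g \<phi> h K) yb
        \<and> adjoint K yb \<in> (\<lambda>u. u + grad_\<phi> xb) ` subdifferential g xb
        \<and> K xb \<in> subdifferential (conjugate h) yb)"
proof -
  define F where "F = (\<lambda>x. g x + ereal (\<phi> x))"
  let ?P = "primal_objective g \<phi> h K" and ?D = "dual_objective g \<phi> h K"
    and ?\<Phi> = "primal_dual_objective g \<phi> h K"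
  have F: "proper_fun F"
    using assms(3) by (auto simp: proper_fun_def edom_def F_def)
  then have F_fin: "F x \<noteq> -\<infinity>" for x by (simp add: proper_fun_def)
  have h_fin: "h x \<noteq> -\<infinity>" for x using assms(6) by (simp add: proper_fun_def)
  have hs: "proper_fun (conjugate h)"
    using assms(6-8) by (rule proper_conjugate)
  then have hs_fin: "conjugate h y \<noteq> -\<infinity>" for y by (simp add: proper_fun_def)
  obtain x0 where x0: "F x0 < \<infinity>"
    using F by (auto simp: proper_fun_def edom_def)
  have Fs_fin: "conjugate F v \<noteq> -\<infinity>" for v
    using Fenchel_Young[of F x0 v] F_fin[of x0] x0 by auto
  have adj: "adjoint K y \<bullet> x = y \<bullet> K x" for x y
    using adjoint_works_finite_dim[OF assms(1,13), of x y] by (simp add: inner_commute)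
  have P_eq: "?P = (\<lambda>x. F x - (h \<circ> K) x)"
    by (simp add: fun_eq_iff primal_objective_def F_def)
  have D_eq: "?D = (\<lambda>y. conjugate h y - (conjugate F \<circ> adjoint K) y)"
    by (simp add: fun_eq_iff dual_objective_def F_def)
  \<comment> \<open>Each of the two groupings isolates the term that is constant in the variable
    being minimized; the bracket that remains has a negated conjugate as its infimum.\<close>
  have Phi_P: "?\<Phi> (x, y) = F x + (conjugate h y - ereal (K x \<bullet> y))" for x y
    by (simp add: primal_dual_objective_def F_def minus_ereal_def add.assoc inner_commute)
  have Phi_D: "?\<Phi> (x, y) = conjugate h y + (F x - ereal (adjoint K y \<bullet> x))" for x y
    by (simp add: primal_dual_objective_def F_def minus_ereal_def add_ac adj)
  \<comment> \<open>The infimum over \<open>y\<close> produces the negated biconjugate of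
    \<open>h\<close> at \<open>K x\<close>, which Fenchel--Moreau turns into
    \<open>- h (K x)\<close>.\<close>
  have P_INF: "?P x = (INF y. ?\<Phi> (x, y))" for x
    unfolding Phi_P INF_ereal_add_const[OF F_fin] uminus_conjugate[symmetric]
      Fenchel_Moreau[OF assms(6-8)] P_eq by (simp add: minus_ereal_def)
  have D_INF: "?D y = (INF x. ?\<Phi> (x, y))" for y
    unfolding Phi_D INF_ereal_add_const[OF hs_fin] uminus_conjugate[symmetric] D_eq
    by (simp add: minus_ereal_def)
  have inf_P: "(INF x. ?P x) = (INF p. ?\<Phi> p)"
    by (simp add: P_INF INF_UNIV_pair)
  have inf_D: "(INF y. ?D y) = (INF p. ?\<Phi> p)"
    by (subst INF_UNIV_pair, subst INF_commute) (simp add: D_INF)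
  have weak: "?\<Phi> (x, y) \<ge> ?P x" "?\<Phi> (x, y) \<ge> ?D y" for x y
    unfolding P_INF D_INF by (auto intro: INF_lower)
  have sum_rule: "subdifferential F x \<subseteq> (\<lambda>u. u + grad_\<phi> x) ` subdifferential g x" for x
    unfolding F_def using assms(3,4,10)
    by (intro subdifferential_add_differentiable) (auto simp: proper_fun_def)
  have primal: "subdifferential (h \<circ> K) x \<subseteq> (\<lambda>u. u + grad_\<phi> x) ` subdifferential g x"
    if "global_minimizer ?P x" for x
  proof -
    have "subdifferential (h \<circ> K) x \<subseteq> subdifferential F x"
      using that h_fin by (intro subdifferential_subset_of_minimizer F) (simp_all add: P_eq)
    then show ?thesis using sum_rule by (rule order_trans)
  qed
  have dual: "subdifferential (conjugate F \<circ> adjoint K) y \<subseteq> subdifferential (conjugate h) y"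
    if "global_minimizer ?D y" for y
    using that Fs_fin by (intro subdifferential_subset_of_minimizer hs) (simp_all add: D_eq)
  have saddle: "global_minimizer ?P x \<and> global_minimizer ?D y
      \<and> adjoint K y \<in> (\<lambda>u. u + grad_\<phi> x) ` subdifferential g x
      \<and> K x \<in> subdifferential (conjugate h) y"
    if "global_minimizer ?\<Phi> (x, y)" for x y
  proof -
    have min: "?\<Phi> (x, y) \<le> ?\<Phi> p" for p
      using that by (cases p) (simp add: global_minimizer_def is_arg_min_linorder)
    then have le_inf: "?\<Phi> (x, y) \<le> (INF p. ?\<Phi> p)" by (rule INF_greatest)
    \<comment> \<open>The chain runs from the marginal to its value under \<open>?\<Phi>\<close>,
      then to the common infimum, then to \<open>?P x'\<close>.\<close>
    have "?P x \<le> ?P x'" for x'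
      by (rule order_trans[OF weak(1)[of x y] order_trans[OF le_inf]])
        (simp add: inf_P[symmetric] INF_lower)
    moreover have "?D y \<le> ?D y'" for y'
      by (rule order_trans[OF weak(2)[of y x] order_trans[OF le_inf]])
        (simp add: inf_D[symmetric] INF_lower)
    ultimately have "global_minimizer ?P x" "global_minimizer ?D y"
      by (simp_all add: global_minimizer_def is_arg_min_linorder)
    moreover obtain y0 where y0: "conjugate h y0 < \<infinity>"
      using hs by (auto simp: proper_fun_def edom_def)
    \<comment> \<open>Comparison with \<open>(x0, y0)\<close>, where \<open>?\<Phi>\<close> is below
      infinity, shows that neither summand is infinite at the minimizer.\<close>
    obtain a where a: "F x = ereal a"
      using min[of "(x0, y0)"] x0 y0 F_fin[of x] F_fin[of x0] hs_fin[of y0]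
      unfolding Phi_P by (cases "F x"; cases "F x0"; cases "conjugate h y0") auto
    obtain b where b: "conjugate h y = ereal b"
      using min[of "(x0, y0)"] x0 y0 hs_fin[of y] F_fin[of x0] hs_fin[of y0]
      unfolding Phi_D by (cases "conjugate h y"; cases "F x0"; cases "conjugate h y0") auto
    \<comment> \<open>With \<open>y\<close> fixed, the finite term \<open>conjugate h y\<close>
      cancels, so \<open>x\<close> minimizes \<open>F\<close> minus a linear form; the same is done
      below with \<open>x\<close> fixed.\<close>
    have "F x - ereal (adjoint K y \<bullet> x) \<le> F x' - ereal (adjoint K y \<bullet> x')" for x'
      using min[of "(x', y)"] F_fin[of x'] unfolding Phi_D by (cases "F x'") (auto simp: a b)
    then have "adjoint K y \<in> subdifferential F x"
      by (rule mem_subdifferential_of_minimizer[OF F])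
    moreover have "conjugate h y - ereal (K x \<bullet> y) \<le> conjugate h y' - ereal (K x \<bullet> y')" for y'
      using min[of "(x, y')"] hs_fin[of y'] unfolding Phi_P
      by (cases "conjugate h y'") (auto simp: a b)
    then have "K x \<in> subdifferential (conjugate h) y"
      by (rule mem_subdifferential_of_minimizer[OF hs])
    ultimately show ?thesis using sum_rule by blast
  qed
  show ?thesis
    using inf_P inf_D weak primal dual saddle unfolding F_def by simp
qed

end
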